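(* Let $\gamma>0$, let $(S,\mathscr{S})$ be a measurable space, let $(\zeta,V)$ be a random variable taking values in $(\mathbb{R}_+\times S,\mathscr{B}_{\mathbb{R}_+}\times\mathscr{S})$, and let $\mu$ be a probability measure on $(S,\mathscr{S})$. (i) Assume that $\sigma:\mathbb{R}_+\to[0,1]$ satisfies $$\sigma(t)\le \inf_{\substack{C\in\mathscr{B}_{\mathbb{R}'_+}\times\mathscr{S}\\ (\nu_\gamma\times\mu)(C)>0}}\frac{\mathbb{P}((\zeta-t,V)\in C)}{(\nu_\gamma\times\mu)(C)}\qquad\forall t\in\mathbb{R}_+,\qquad(\ast)$$ and that $G:\mathbb{R}_+\to\mathbb{R}_+$, defined by $G(t)=\sigma(t)e^{\gamma t}$, is nondecreasing and right-continuous. Then one can define, on the same probability space as $(\zeta,V)$ (possibly after replacing that space by another one carrying a copy of $(\zeta,V)$ with the same distribution), a nonnegative random variable $\hat\zeta$ such that $$\mathbb{P}(\hat\zeta\le t,\zeta\le u,V\in A)=\mathbb{P}(\zeta\le t\wedge u,V\in A)+\sigma(t)\bigl(1-e^{-\gamma[u-t]_+}\bigr)\mu(A)\qquad\forall (t,u,A)\in\mathbb{R}_+\times\mathbb{R}_+\times\mathscr{S},$$ and such that $\mathbb{P}(\hat\zeta\le\zeta)=1$ and $\mathscr{L}((\zeta-t,V)\mid\hat\zeta\le t,\zeta>t)=\nu_\gamma\times\mu$ for each $t\in\mathbb{R}_+$. (ii) In particular, the conditions on $\sigma$ and $G$ in (i) are satisfied if $\sigma$ is defined by equality in $(\ast)$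 for all $t\in\mathbb{R}_+$. (iii) Conversely, assume that a nonnegative random variable $\hat\zeta$, defined on the same probability space as $(\zeta,V)$, satisfies $\mathbb{P}(\hat\zeta\le\zeta)=1$ and $\mathscr{L}((\zeta-t,V)\mid\hat\zeta\le t,\zeta>t)=\nu_\gamma\times\mu$ for each $t\in\mathbb{R}_+$. Then $\sigma:\mathbb{R}_+\to[0,1]$, defined by $\sigma(t)=\mathbb{P}(\hat\zeta\le t,\zeta>t)$, satisfies $(\ast)$, and $G:\mathbb{R}_+\to\mathbb{R}_+$, defined by $G(t)=\sigma(t)e^{\gamma t}$, is nondecreasing and right-continuous.
   Context: $\mathbb{R}_+=[0,\infty)$, $\mathbb{R}'_+=(0,\infty)$; $\mathscr{B}_T$ is the Borel $\sigma$-algebra of a topological space $T$; $\mathscr{B}\times\mathscr{S}$ denotes the product $\sigma$-algebra. $\mathscr{L}(X)$ is the distribution of $X$. $\nu_\gamma$ is the exponential distribution with mean $\gamma^{-1}$. $[x]_+=\max(x,0)$ and $t\wedge u=\min(t,u)$. A statement $\mathscr{L}((\zeta-t,V)\mid\hat\zeta\le t,\zeta>t)=\nu_\gamma\times\mu$ is understood as vacuous when the conditioning event has probability $0$. A random variable $\hat\zeta$ as in (i) is called a strong memoryless time. *)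

theory Defs
  imports "HOL-Probability.Probability"
begin

definition exp_law :: "real \<Rightarrow> real measure" where
  "exp_law \<gamma> = density lborel (\<lambda>x. ennreal (exponential_density \<gamma> x))"

text \<open>Conditional distribution of the \<open>N\<close>-valued variable \<open>X\<close> given an event \<open>E\<close>; only meaningful
  if \<open>E\<close> has positive probability.\<close>

definition cond_law :: "'a measure \<Rightarrow> 'b measure \<Rightarrow> ('a \<Rightarrow> 'b) \<Rightarrow> 'a set \<Rightarrow> 'b measure" where
  "cond_law M N X E = distr (uniform_measure M E) N X"

text \<open>The infimum is taken in the reals: the index set contains \<open>{0<..} \<times> space S\<close>, and all ratios
  are nonnegative. The sets \<open>C\<close> are measurable subsets of \<open>{0<..} \<times> space S\<close>.\<close>

definition sigma_bound ::
  "real \<Rightarrow> 's measure \<Rightarrow> 's measure \<Rightarrow> 'a measure \<Rightarrow> ('a \<Rightarrow> real) \<Rightarrow> ('a \<Rightarrow> 's) \<Rightarrow> real \<Rightarrow> real" where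
  "sigma_bound \<gamma> S \<mu> M \<zeta> V t =
     (INF C \<in> {C \<in> sets (restrict_space borel {0<..} \<Otimes>\<^sub>M S). measure (exp_law \<gamma> \<Otimes>\<^sub>M \<mu>) C > 0}.
        \<P>(\<omega> in M. (\<zeta> \<omega> - t, V \<omega>) \<in> C) / measure (exp_law \<gamma> \<Otimes>\<^sub>M \<mu>) C)"

text \<open>Functions on $[0,\infty)$ are functions on the reals of which only the values at nonnegative
  arguments matter.\<close>

definition admissible ::
  "real \<Rightarrow> 's measure \<Rightarrow> 's measure \<Rightarrow> 'a measure \<Rightarrow> ('a \<Rightarrow> real) \<Rightarrow> ('a \<Rightarrow> 's) \<Rightarrow> (real \<Rightarrow> real) \<Rightarrow> bool"
  where
  "admissible \<gamma> S \<mu> M \<zeta> V \<sigma> \<longleftrightarrow>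
     (\<forall>t\<ge>0. 0 \<le> \<sigma> t \<and> \<sigma> t \<le> 1) \<and>
     (\<forall>t\<ge>0. \<sigma> t \<le> sigma_bound \<gamma> S \<mu> M \<zeta> V t) \<and>
     mono_on {0..} (\<lambda>t. \<sigma> t * exp (\<gamma> * t)) \<and>
     (\<forall>t\<ge>0. continuous (at_right t) (\<lambda>t. \<sigma> t * exp (\<gamma> * t)))"

definition strong_memoryless_time ::
  "real \<Rightarrow> 's measure \<Rightarrow> 's measure \<Rightarrow> 'a measure \<Rightarrow> ('a \<Rightarrow> real) \<Rightarrow> ('a \<Rightarrow> 's) \<Rightarrow> ('a \<Rightarrow> real) \<Rightarrow> bool"
  where
  "strong_memoryless_time \<gamma> S \<mu> M \<zeta> V \<zeta>h \<longleftrightarrow>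
     \<zeta>h \<in> measurable M (restrict_space borel {0..}) \<and>
     \<P>(\<omega> in M. \<zeta>h \<omega> \<le> \<zeta> \<omega>) = 1 \<and>
     (\<forall>t\<ge>0. \<P>(\<omega> in M. \<zeta>h \<omega> \<le> t \<and> \<zeta> \<omega> > t) > 0 \<longrightarrow>
        cond_law M (borel \<Otimes>\<^sub>M S) (\<lambda>\<omega>. (\<zeta> \<omega> - t, V \<omega>)) {\<omega> \<in> space M. \<zeta>h \<omega> \<le> t \<and> \<zeta> \<omega> > t}
          = exp_law \<gamma> \<Otimes>\<^sub>M \<mu>)"

end

theory Submission
  imports Defs
begin

text \<open>
  Let \<open>\<rho>\<close> be the product of the exponential law and \<open>\<mu>\<close>, and put
  \<open>G t = \<sigma> t * exp (\<gamma> * t)\<close>. Since the exponential law is memoryless, the bound on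
  \<open>\<sigma> t\<close> says precisely that \<open>G t * \<rho>\<close> is dominated by the law of \<open>(\<zeta>, V)\<close> on
  \<open>{t<..} \<times> S\<close>. In this form the condition visibly passes to larger \<open>t\<close> and to limits from
  the right, which makes the largest admissible \<open>G\<close> monotone and right-continuous. Given
  \<open>\<sigma>\<close>, let \<open>h\<close> be the density, with respect to the law of \<open>(\<zeta>, V)\<close>, of the part of \<open>\<rho>\<close>
  that is dominated in this way, and let \<open>U\<close> be uniform and independent of \<open>(\<zeta>, V)\<close>. The memoryless time is the first \<open>t\<close> with
  \<open>\<zeta> \<le> t\<close> or \<open>U \<le> G t * h (\<zeta>, V)\<close>.
\<close>

section \<open>Product measurability on a subspace; right-continuity of monotone functions\<close>

text \<open>The identity is measurable both from the subspace of the product to the product with the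
  subspace and from the latter into the full product. This allows the index sets of
  \<open>sigma_bound\<close> to be handled as ordinary product sets.\<close>

lemma sets_restrict_space_times_iff:
  assumes "B \<in> sets borel"
  shows "C \<in> sets (restrict_space borel B \<Otimes>\<^sub>M S) \<longleftrightarrow> C \<in> sets (borel \<Otimes>\<^sub>M S) \<and> C \<subseteq> B \<times> space S"
proof
  assume C: "C \<in> sets (restrict_space borel B \<Otimes>\<^sub>M S)"
  then have sub: "C \<subseteq> B \<times> space S"
    using sets.sets_into_space[OF C] by (auto simp: space_pair_measure space_restrict_space)
  have "(\<lambda>p. p) \<in> restrict_space (borel \<Otimes>\<^sub>M S) (B \<times> space S) \<rightarrow>\<^sub>M restrict_space borel B \<Otimes>\<^sub>M S"
  proof (rule measurable_pair)
    show "fst \<circ> (\<lambda>p. p) \<in> restrict_space (borel \<Otimes>\<^sub>M S) (B \<times> space S) \<rightarrow>\<^sub>M restrict_space borel B"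
      unfolding comp_def
      by (intro measurable_restrict_space2 measurable_restrict_space1)
         (auto simp: space_restrict_space space_pair_measure)
  qed (simp add: comp_def measurable_restrict_space1)
  from measurable_sets[OF this C] sub
  have "C \<in> sets (restrict_space (borel \<Otimes>\<^sub>M S) (B \<times> space S))"
    by (simp add: space_restrict_space space_pair_measure Times_Int_Times Int_absorb2)
  then show "C \<in> sets (borel \<Otimes>\<^sub>M S) \<and> C \<subseteq> B \<times> space S"
    using sub assms by (subst (asm) sets_restrict_space_iff) (auto simp: space_pair_measure)
next
  assume C: "C \<in> sets (borel \<Otimes>\<^sub>M S) \<and> C \<subseteq> B \<times> space S"
  have "(\<lambda>p. p) \<in> restrict_space borel B \<Otimes>\<^sub>M S \<rightarrow>\<^sub>M borel \<Otimes>\<^sub>M S"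
  proof (rule measurable_pair)
    have "fst \<in> restrict_space borel B \<Otimes>\<^sub>M S \<rightarrow>\<^sub>M restrict_space borel B" by simp
    then show "fst \<circ> (\<lambda>p. p) \<in> restrict_space borel B \<Otimes>\<^sub>M S \<rightarrow>\<^sub>M borel"
      by (simp add: comp_def measurable_restrict_space2_iff)
  qed (simp add: comp_def)
  from measurable_sets[OF this, of C] C
  show "C \<in> sets (restrict_space borel B \<Otimes>\<^sub>M S)"
    by (simp add: space_restrict_space space_pair_measure Int_absorb2)
qed

text \<open>Monotonicity already gives the lower half of the limit from the right. For the upper
  half one point \<open>s\<close> suffices, since all values between \<open>t\<close> and
  \<open>s\<close> lie below \<open>f s\<close>.\<close>

lemma right_continuous_mono_onI:
  fixes f :: "real \<Rightarrow> real"
  assumes mono: "mono_on {a..} f" and "a \<le> t" and upper: "\<And>y. f t < y \<Longrightarrow> \<exists>s>t. f s < y"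
  shows "continuous (at_right t) f"
  unfolding continuous_within
proof (rule order_tendstoI)
  have le: "f s \<le> f r" if "t \<le> s" "s \<le> r" for s r
    using monotone_onD[OF mono, of s r] that \<open>a \<le> t\<close> by simp
  show "\<forall>\<^sub>F x in at_right t. y < f x" if "y < f t" for y
    unfolding eventually_at_right_field
    using that le[of t] by (intro exI[of _ "t + 1"]) (auto intro: less_le_trans)
  show "\<forall>\<^sub>F x in at_right t. f x < y" if y: "f t < y" for y
  proof -
    obtain s where s: "s > t" "f s < y" using upper[OF y] by blast
    have "f x < y" if "t < x" "x < s" for x
      using le[of x s] that s by simp
    then show ?thesis
      using s unfolding eventually_at_right_field by blast
  qed
qed

section \<open>The reference law \<open>\<rho>\<close> and the law of the given pair\<close>

locale memoryless_setup = prob_space M + mark: prob_space \<mu>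
  for \<gamma> :: real and S \<mu> :: "'s measure" and M :: "'a measure"
    and \<zeta> :: "'a \<Rightarrow> real" and V :: "'a \<Rightarrow> 's" +
  assumes \<gamma>_pos: "\<gamma> > 0"
    and pair_meas0: "(\<lambda>\<omega>. (\<zeta> \<omega>, V \<omega>)) \<in> measurable M (restrict_space borel {0..} \<Otimes>\<^sub>M S)"
    and sets_\<mu> [measurable_cong, simp]: "sets \<mu> = sets S"
begin

abbreviation \<rho> :: "(real \<times> 's) measure" where
  "\<rho> \<equiv> exp_law \<gamma> \<Otimes>\<^sub>M \<mu>"

text \<open>The first factor is the whole real line, so that sets can be translated in the first
  coordinate without leaving the space.\<close>

definition law :: "(real \<times> 's) measure" where
  "law = distr M (borel \<Otimes>\<^sub>M S) (\<lambda>\<omega>. (\<zeta> \<omega>, V \<omega>))"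

definition tail :: "real \<Rightarrow> (real \<times> 's) set" where
  "tail t = {t<..} \<times> space S"

lemma sets_exp_law [measurable_cong, simp]: "sets (exp_law \<gamma>) = sets borel"
  by (simp add: exp_law_def)

lemma sets_\<rho> [simp]: "sets \<rho> = sets (borel \<Otimes>\<^sub>M S)"
  by (intro sets_pair_measure_cong) auto

lemma space_\<mu> [simp]: "space \<mu> = space S"
  by (rule sets_eq_imp_space_eq) simp

lemma prob_space_exp_law: "prob_space (exp_law \<gamma>)"
  unfolding exp_law_def using prob_space_exponential_density[OF \<gamma>_pos] by simp

sublocale \<rho>: prob_space \<rho>
proof -
  interpret e: prob_space "exp_law \<gamma>" by (rule prob_space_exp_law)
  interpret pair_prob_space "exp_law \<gamma>" \<mu> ..
  show "prob_space \<rho>" by unfold_locales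
qed

lemma \<zeta>_meas [measurable]: "\<zeta> \<in> borel_measurable M"
proof -
  have "fst \<circ> (\<lambda>\<omega>. (\<zeta> \<omega>, V \<omega>)) \<in> M \<rightarrow>\<^sub>M restrict_space borel {0..}"
    using pair_meas0 by (rule measurable_comp) simp
  then show ?thesis by (simp add: comp_def measurable_restrict_space2_iff)
qed

lemma V_meas [measurable]: "V \<in> M \<rightarrow>\<^sub>M S"
proof -
  have "snd \<circ> (\<lambda>\<omega>. (\<zeta> \<omega>, V \<omega>)) \<in> M \<rightarrow>\<^sub>M S"
    using pair_meas0 by (rule measurable_comp) simp
  then show ?thesis by (simp add: comp_def)
qed

lemma \<zeta>_nonneg: "\<omega> \<in> space M \<Longrightarrow> 0 \<le> \<zeta> \<omega>"
  using measurable_space[OF pair_meas0, of \<omega>] by (auto simp: space_pair_measure space_restrict_space)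

lemma V_space: "\<omega> \<in> space M \<Longrightarrow> V \<omega> \<in> space S"
  using measurable_space[OF V_meas] .

lemma sets_law [measurable_cong, simp]: "sets law = sets (borel \<Otimes>\<^sub>M S)"
  by (simp add: law_def)

lemma space_law [simp]: "space law = UNIV \<times> space S"
  by (simp add: law_def space_pair_measure)

sublocale law: prob_space law
  unfolding law_def by (rule prob_space_distr) simp

lemma law_eq: "D \<in> sets (borel \<Otimes>\<^sub>M S) \<Longrightarrow>
    measure law D = \<P>(\<omega> in M. (\<zeta> \<omega>, V \<omega>) \<in> D)"
  by (auto simp: law_def measure_distr vimage_def Int_def intro!: arg_cong[of _ _ "measure M"])

lemma tail_meas [measurable, simp]: "tail t \<in> sets (borel \<Otimes>\<^sub>M S)"
  by (simp add: tail_def)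

lemma shift_meas: "(\<lambda>p. (fst p + t, snd p)) \<in> (borel \<Otimes>\<^sub>M S) \<rightarrow>\<^sub>M (borel \<Otimes>\<^sub>M S)"
  for t :: real by measurable

section \<open>Memorylessness of \<open>\<rho>\<close>\<close>

text \<open>The part of \<open>D\<close> above level \<open>t\<close>, moved down by
  \<open>t\<close>. It is the set \<open>C\<close> for which \<open>(\<zeta> - t, V)\<close> lies in
  \<open>C\<close> exactly when \<open>(\<zeta>, V)\<close> lies in \<open>D\<close> and
  \<open>\<zeta> > t\<close>.\<close>

definition shift_set :: "real \<Rightarrow> (real \<times> 's) set \<Rightarrow> (real \<times> 's) set" where
  "shift_set t D = {p \<in> tail 0. (fst p + t, snd p) \<in> D}"

lemma sets_shift_set [measurable, simp]:
  assumes "D \<in> sets (borel \<Otimes>\<^sub>M S)" shows "shift_set t D \<in> sets (borel \<Otimes>\<^sub>M S)"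
proof -
  have "shift_set t D = (\<lambda>p. (fst p + t, snd p)) -` D \<inter> space (borel \<Otimes>\<^sub>M S) \<inter> tail 0"
    by (auto simp: shift_set_def tail_def space_pair_measure)
  also have "\<dots> \<in> sets (borel \<Otimes>\<^sub>M S)"
    using measurable_sets[OF shift_meas assms] by simp
  finally show ?thesis .
qed

text \<open>Integrating sections over the first coordinate and substituting \<open>t + x\<close> for
  \<open>x\<close> pulls the factor \<open>exp (- \<gamma> * t)\<close> out of the exponential
  density.\<close>

lemma \<rho>_shift:
  assumes D [measurable]: "D \<in> sets (borel \<Otimes>\<^sub>M S)" and "0 \<le> t"
  shows "measure \<rho> (D \<inter> tail t) = exp (- \<gamma> * t) * measure \<rho> (shift_set t D)"
proof -
  have emeas: "emeasure \<rho> X = (\<integral>\<^sup>+x. ennreal (exponential_density \<gamma> x) * emeasure \<mu> (Pair x -` X) \<partial>lborel)"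
    if [measurable]: "X \<in> sets (borel \<Otimes>\<^sub>M S)" for X
  proof -
    have [measurable]: "X \<in> sets (borel \<Otimes>\<^sub>M \<mu>)"
      using that by (simp cong: sets_pair_measure_cong)
    have "emeasure \<rho> X = (\<integral>\<^sup>+x. emeasure \<mu> (Pair x -` X) \<partial>exp_law \<gamma>)"
      using that by (intro mark.emeasure_pair_measure_alt) simp
    also have "\<dots> = (\<integral>\<^sup>+x. ennreal (exponential_density \<gamma> x) * emeasure \<mu> (Pair x -` X) \<partial>lborel)"
      unfolding exp_law_def
      by (rule nn_integral_density) (auto intro!: mark.measurable_emeasure_Pair)
    finally show ?thesis .
  qed
  have [measurable]: "D \<inter> tail t \<in> sets (borel \<Otimes>\<^sub>M \<mu>)"
    using D by (simp cong: sets_pair_measure_cong)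
  have sD: "shift_set t D \<in> sets (borel \<Otimes>\<^sub>M \<mu>)"
    using D by (simp cong: sets_pair_measure_cong)
  have "emeasure \<rho> (D \<inter> tail t) =
      (\<integral>\<^sup>+x. ennreal (exponential_density \<gamma> x) * emeasure \<mu> (Pair x -` (D \<inter> tail t)) \<partial>lborel)"
    by (rule emeas) simp
  also have "\<dots> = (\<integral>\<^sup>+x. ennreal (exponential_density \<gamma> (t + x)) *
      emeasure \<mu> (Pair (t + x) -` (D \<inter> tail t)) \<partial>lborel)"
    using mark.measurable_emeasure_Pair[of "D \<inter> tail t" borel]
    by (subst nn_integral_real_affine[where c=1 and t=t]) auto
  also have "\<dots> = (\<integral>\<^sup>+x. ennreal (exp (- \<gamma> * t)) * (ennreal (exponential_density \<gamma> x) *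
      emeasure \<mu> (Pair x -` shift_set t D)) \<partial>lborel)"
  \<comment> \<open>The density factorizes only for nonnegative \<open>x\<close>. For negative
    \<open>x\<close> the section of \<open>shift_set t D\<close> is empty; the null point 0 is
    dropped so that only strict signs remain.\<close>
  proof (rule nn_integral_cong_AE, use AE_lborel_singleton[of 0] in eventually_elim)
    fix x :: real assume "x \<noteq> 0"
    have "Pair (t + x) -` (D \<inter> tail t) = Pair x -` shift_set t D"
      using sets.sets_into_space[OF D]
      by (auto simp: space_pair_measure shift_set_def tail_def add.commute)
    moreover have "Pair x -` shift_set t D = {}" if "x < 0"
      using that by (auto simp: shift_set_def tail_def)
    moreover have "ennreal (exponential_density \<gamma> (t + x)) =
        ennreal (exp (- \<gamma> * t)) * ennreal (exponential_density \<gamma> x)" if "x > 0"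
    proof -
      have "exponential_density \<gamma> (t + x) = exp (- \<gamma> * t) * exponential_density \<gamma> x"
        using that \<open>0 \<le> t\<close> by (simp add: exponential_density_def exp_add[symmetric] algebra_simps)
      then show ?thesis
        by (simp add: ennreal_mult exponential_density_nonneg \<gamma>_pos)
    qed
    ultimately show "ennreal (exponential_density \<gamma> (t + x)) * emeasure \<mu> (Pair (t + x) -` (D \<inter> tail t)) =
        ennreal (exp (- \<gamma> * t)) * (ennreal (exponential_density \<gamma> x) * emeasure \<mu> (Pair x -` shift_set t D))"
      using \<open>x \<noteq> 0\<close> by (cases "x < 0") (simp_all add: mult.assoc)
  qed
  also have "\<dots> = ennreal (exp (- \<gamma> * t)) * emeasure \<rho> (shift_set t D)"
    using mark.measurable_emeasure_Pair[OF sD]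
    by (subst nn_integral_cmult) (auto simp: emeas)
  finally show ?thesis
    by (simp add: \<rho>.emeasure_eq_measure ennreal_mult[symmetric])
qed

text \<open>The exponential law puts no mass on \<open>{..0}\<close>.\<close>

lemma \<rho>_tail0: 
  assumes "D \<in> sets (borel \<Otimes>\<^sub>M S)"
  shows "measure \<rho> (D \<inter> tail 0) = measure \<rho> D"
proof -
  have "shift_set 0 D = D \<inter> tail 0" by (auto simp: shift_set_def)
  have "AE x in exp_law \<gamma>. 0 < x"
    unfolding exp_law_def using AE_lborel_singleton[of "0::real"] by (subst AE_density) (auto simp: exponential_density_def)
  then have "emeasure \<rho> ({..0} \<times> space S) = 0"
    using mark.emeasure_pair_measure_Times[of "{..0}" "exp_law \<gamma>" "space S"]
    by (simp add: AE_iff_measurable[of "{..0}"] not_less exp_law_def atMost_def)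
  then have "AE p in \<rho>. p \<in> tail 0"
    by (intro AE_I[of _ _ "{..0} \<times> space S"]) (auto simp: tail_def space_pair_measure)
  then show ?thesis using assms
    by (intro measure_eq_AE) auto
qed

lemma \<rho>_tail_Times:
  assumes "A \<in> sets S" "0 \<le> t"
  shows "measure \<rho> ((UNIV \<times> A) \<inter> tail t) = exp (- \<gamma> * t) * measure \<mu> A"
proof -
  have "shift_set t (UNIV \<times> A) = (UNIV \<times> A) \<inter> tail 0"
    by (auto simp: shift_set_def tail_def)
  moreover have "measure \<rho> (UNIV \<times> A) = measure \<mu> A"
  proof -
    interpret e: prob_space "exp_law \<gamma>" by (rule prob_space_exp_law)
    have "emeasure (exp_law \<gamma>) UNIV = 1"
      using e.emeasure_space_1 by (simp add: exp_law_def)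
    then show ?thesis
      using assms mark.emeasure_pair_measure_Times[of UNIV "exp_law \<gamma>" A]
      by (simp add: measure_def)
  qed
  ultimately show ?thesis
    using assms \<rho>_shift[of "UNIV \<times> A" t] \<rho>_tail0[of "UNIV \<times> A"] by simp
qed

lemma \<rho>_tail: "0 \<le> t \<Longrightarrow> measure \<rho> (tail t) = exp (- \<gamma> * t)"
  using \<rho>_tail_Times[of "space S" t] mark.prob_space by (simp add: tail_def Times_Int_Times)

section \<open>The bound on \<open>\<sigma>\<close> as domination of measures\<close>

text \<open>Take \<open>C = shift_set t D\<close> in the infimum: the numerator becomes the
  \<open>law\<close> of \<open>D \<inter> tail t\<close>, and by \<open>\<rho>_shift\<close> the
  denominator becomes \<open>exp (\<gamma> * t)\<close> times its
  \<open>\<rho>\<close>-mass.\<close>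

lemma le_sigma_bound_iff:
  assumes "0 \<le> t"
  shows "x \<le> sigma_bound \<gamma> S \<mu> M \<zeta> V t \<longleftrightarrow>
    (\<forall>D\<in>sets (borel \<Otimes>\<^sub>M S). x * exp (\<gamma> * t) * measure \<rho> (D \<inter> tail t) \<le> measure law (D \<inter> tail t))"
    (is "?L \<longleftrightarrow> ?R")
proof -
  define \<C> where "\<C> = {C \<in> sets (restrict_space borel {0<..} \<Otimes>\<^sub>M S). measure \<rho> C > 0}"
  have \<C>_iff: "C \<in> \<C> \<longleftrightarrow> C \<in> sets (borel \<Otimes>\<^sub>M S) \<and> C \<subseteq> tail 0 \<and> measure \<rho> C > 0" for C
    unfolding \<C>_def mem_Collect_eq sets_restrict_space_times_iff[OF borel_open[OF open_greaterThan]] tail_def by blast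
  have law_shift: "measure law (D \<inter> tail t) = \<P>(\<omega> in M. (\<zeta> \<omega> - t, V \<omega>) \<in> shift_set t D)"
    if "D \<in> sets (borel \<Otimes>\<^sub>M S)" for D
    using that V_space
    by (subst law_eq) (auto simp: shift_set_def tail_def intro!: arg_cong[of _ _ "measure M"])
  have "tail 0 \<in> \<C>"
    using \<rho>_tail[of 0] by (simp add: \<C>_iff)
  show ?thesis
  proof
    assume L: ?L
    show ?R
    proof
      fix D :: "(real \<times> 's) set" assume D: "D \<in> sets (borel \<Otimes>\<^sub>M S)"
      let ?C = "shift_set t D"
      \<comment> \<open>A set that is null for \<open>\<rho>\<close> is not in the index set of the
        infimum, but then the left side of the inequality is 0.\<close>
      have "measure \<rho> ?C = 0 \<or> ?C \<in> \<C>"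
        using D measure_nonneg[of \<rho> ?C]
        by (auto simp: \<C>_iff shift_set_def simp del: measure_nonneg)
      then consider "measure \<rho> ?C = 0" | "?C \<in> \<C>" by blast
      then show "x * exp (\<gamma> * t) * measure \<rho> (D \<inter> tail t) \<le> measure law (D \<inter> tail t)"
      proof cases
        case 2
        have "x \<le> \<P>(\<omega> in M. (\<zeta> \<omega> - t, V \<omega>) \<in> ?C) / measure \<rho> ?C"
          using L 2 unfolding sigma_bound_def \<C>_def[symmetric]
          by (elim order_trans) (auto intro!: cINF_lower bdd_belowI2[of _ 0])
        then have "x * measure \<rho> ?C \<le> measure law (D \<inter> tail t)"
          using 2 by (simp add: law_shift D \<C>_iff pos_le_divide_eq)
        then show ?thesis
          by (simp add: \<rho>_shift[OF D assms] exp_minus field_simps)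
      qed (simp add: \<rho>_shift[OF D assms])
    qed
  next
    assume R: ?R
    show ?L unfolding sigma_bound_def \<C>_def[symmetric]
    proof (rule cINF_greatest)
      show "\<C> \<noteq> {}" using \<open>tail 0 \<in> \<C>\<close> by auto
      fix C assume C: "C \<in> \<C>"
      \<comment> \<open>\<open>C\<close> moved up by \<open>t\<close>; thus every index set arises
        as some \<open>shift_set t D\<close>.\<close>
      define D where "D = (\<lambda>p. (fst p + (-t), snd p)) -` C \<inter> space (borel \<Otimes>\<^sub>M S)"
      have D: "D \<in> sets (borel \<Otimes>\<^sub>M S)"
        unfolding D_def using C by (intro measurable_sets[OF shift_meas]) (simp add: \<C>_iff)
      have sD: "shift_set t D = C"
        using C by (auto simp: shift_set_def D_def \<C>_iff tail_def space_pair_measure)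
      have "x * exp (\<gamma> * t) * measure \<rho> (D \<inter> tail t) \<le> measure law (D \<inter> tail t)"
        using R D by blast
      then have "x * measure \<rho> C \<le> \<P>(\<omega> in M. (\<zeta> \<omega> - t, V \<omega>) \<in> C)"
        unfolding \<rho>_shift[OF D assms] law_shift[OF D] sD by (simp add: exp_minus field_simps)
      then show "x \<le> \<P>(\<omega> in M. (\<zeta> \<omega> - t, V \<omega>) \<in> C) / measure \<rho> C"
        using C by (simp add: \<C>_iff pos_le_divide_eq)
    qed
  qed
qed

text \<open>The factor \<open>g\<close> stands for \<open>G t\<close>, but is a separate argument so
  that it can stay fixed while \<open>t\<close> moves.\<close>

definition dominated :: "real \<Rightarrow> real \<Rightarrow> bool" where
  "dominated t g \<longleftrightarrow>
     (\<forall>D\<in>sets (borel \<Otimes>\<^sub>M S). g * measure \<rho> (D \<inter> tail t) \<le> measure law (D \<inter> tail t))"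

lemma le_sigma_bound_iff_dominated:
  "0 \<le> t \<Longrightarrow> x \<le> sigma_bound \<gamma> S \<mu> M \<zeta> V t \<longleftrightarrow> dominated t (x * exp (\<gamma> * t))"
  unfolding dominated_def by (rule le_sigma_bound_iff)

text \<open>Subsets of \<open>tail t\<close> are subsets of \<open>tail s\<close>, so their
  inequalities are among those already known.\<close>

lemma dominated_mono:
  assumes "dominated s g" "s \<le> t"
  shows "dominated t g"
  unfolding dominated_def
proof
  fix D :: "(real \<times> 's) set" assume D: "D \<in> sets (borel \<Otimes>\<^sub>M S)"
  have "D \<inter> tail t \<inter> tail s = D \<inter> tail t"
    using \<open>s \<le> t\<close> by (auto simp: tail_def)
  then show "g * measure \<rho> (D \<inter> tail t) \<le> measure law (D \<inter> tail t)"
    using assms(1) D by (auto simp: dominated_def dest!: bspec[of _ _ "D \<inter> tail t"])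
qed

text \<open>Since \<open>tail t\<close> is open at its left end, it is the increasing union of the
  \<open>tail (t + 1/(n+1))\<close>; continuity from below carries the inequality over.\<close>

lemma dominated_right_limit:
  assumes "\<And>s. s > t \<Longrightarrow> dominated s g" "g \<ge> 0"
  shows "dominated t g"
  unfolding dominated_def
proof
  fix D :: "(real \<times> 's) set" assume D: "D \<in> sets (borel \<Otimes>\<^sub>M S)"
  define E where "E n = D \<inter> tail (t + inverse (real (Suc n)))" for n
  have E_sets: "range E \<subseteq> sets (borel \<Otimes>\<^sub>M S)" using D by (auto simp: E_def)
  have "incseq E"
  proof (rule incseq_SucI)
    fix n
    have "inverse (real (Suc (Suc n))) \<le> inverse (real (Suc n))"
      by (rule le_imp_inverse_le) auto
    then have "tail (t + inverse (real (Suc n))) \<subseteq> tail (t + inverse (real (Suc (Suc n))))"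
      unfolding tail_def by (intro Sigma_mono) simp_all
    then show "E n \<subseteq> E (Suc n)" unfolding E_def by blast
  qed
  have UE: "(\<Union>n. E n) = D \<inter> tail t"
  proof
    show "D \<inter> tail t \<subseteq> (\<Union>n. E n)"
    proof
      fix p assume p: "p \<in> D \<inter> tail t"
      then have "0 < fst p - t" by (auto simp: tail_def)
      from reals_Archimedean[OF this] obtain n where "inverse (real (Suc n)) < fst p - t" by blast
      with p show "p \<in> (\<Union>n. E n)" by (auto simp: E_def tail_def intro!: exI[of _ n])
    qed
    show "(\<Union>n. E n) \<subseteq> D \<inter> tail t"
    proof
      fix p assume "p \<in> (\<Union>n. E n)"
      then obtain n where "p \<in> E n" by blast
      moreover have "tail (t + inverse (real (Suc n))) \<subseteq> tail t"
        unfolding tail_def by (intro Sigma_mono) simp_all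
      ultimately show "p \<in> D \<inter> tail t"
        unfolding E_def by blast
    qed
  qed
  have "(\<lambda>n. measure \<rho> (E n)) \<longlonglongrightarrow> measure \<rho> (\<Union>n. E n)"
    using E_sets \<open>incseq E\<close> by (intro \<rho>.finite_Lim_measure_incseq) auto
  then have lim: "(\<lambda>n. g * measure \<rho> (E n)) \<longlonglongrightarrow> g * measure \<rho> (D \<inter> tail t)"
    unfolding UE by (intro tendsto_intros)
  show "g * measure \<rho> (D \<inter> tail t) \<le> measure law (D \<inter> tail t)"
  proof (rule LIMSEQ_le_const2[OF lim], intro exI allI impI)
    fix n :: nat
    have "g * measure \<rho> (E n) \<le> measure law (E n)"
      using assms(1)[of "t + inverse (real (Suc n))"] D by (auto simp: dominated_def E_def)
    also have "\<dots> \<le> measure law (D \<inter> tail t)"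
      using D UE by (intro law.finite_measure_mono) auto
    finally show "g * measure \<rho> (E n) \<le> measure law (D \<inter> tail t)" .
  qed
qed

section \<open>Part (ii): the largest bound is admissible\<close>

text \<open>\<open>G t\<close> is the greatest \<open>g\<close> with \<open>dominated t g\<close>.
  Hence monotonicity comes from \<open>dominated_mono\<close> and right-continuity from
  \<open>dominated_right_limit\<close>.\<close>

lemma admissible_sigma_bound: "admissible \<gamma> S \<mu> M \<zeta> V (sigma_bound \<gamma> S \<mu> M \<zeta> V)"
proof -
  define G where "G t = sigma_bound \<gamma> S \<mu> M \<zeta> V t * exp (\<gamma> * t)" for t
  have dom: "dominated t (G t)" if "0 \<le> t" for t
    using le_sigma_bound_iff_dominated[OF that, of "sigma_bound \<gamma> S \<mu> M \<zeta> V t"] by (simp add: G_def)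
  have max: "g \<le> G t" if "dominated t g" "0 \<le> t" for t g
  proof -
    have eq: "g * exp (- \<gamma> * t) * exp (\<gamma> * t) = g" by (simp add: exp_minus)
    have "g * exp (- \<gamma> * t) \<le> sigma_bound \<gamma> S \<mu> M \<zeta> V t"
      using that by (simp only: le_sigma_bound_iff_dominated eq)
    then have "g * exp (- \<gamma> * t) * exp (\<gamma> * t) \<le> G t"
      unfolding G_def by (rule mult_right_mono) simp
    then show ?thesis by (simp only: eq)
  qed
  have G_nonneg: "0 \<le> G t" if "0 \<le> t" for t
    using that by (intro max) (auto simp: dominated_def)
  have mono: "mono_on {0..} G"
    by (intro mono_onI max) (auto intro: dominated_mono dom)
  have cont: "continuous (at_right t) G" if "0 \<le> t" for t
  proof (rule right_continuous_mono_onI[OF mono that])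
    fix y assume "G t < y"
    show "\<exists>s>t. G s < y"
    proof (rule ccontr)
      assume *: "\<not> (\<exists>s>t. G s < y)"
      have "y > 0" using G_nonneg[OF that] \<open>G t < y\<close> by simp
      \<comment> \<open>If \<open>G\<close> stayed at or above \<open>y\<close> to the right of
        \<open>t\<close>, then \<open>y\<close> would be a dominated factor at each such time, hence
        also at \<open>t\<close>, against the maximality of \<open>G t < y\<close>.\<close>
      have "dominated s y" if "s > t" for s
      proof -
        have "y \<le> G s" using * that by (force simp: not_less)
        then have "y * measure \<rho> (D \<inter> tail s) \<le> G s * measure \<rho> (D \<inter> tail s)" for D
          by (intro mult_right_mono) auto
        then show ?thesis
          using dom[of s] that \<open>0 \<le> t\<close> unfolding dominated_def
          by (auto intro: order_trans)
      qed
      then have "dominated t y" using \<open>y > 0\<close> by (rule dominated_right_limit[OF _ less_imp_le])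
      then show False using max[of t y] that \<open>G t < y\<close> by simp
    qed
  qed
  have "sigma_bound \<gamma> S \<mu> M \<zeta> V t \<le> 1" if "0 \<le> t" for t
  proof -
    \<comment> \<open>The whole tail as test set: its \<open>\<rho>\<close>-mass cancels the
      exponential in \<open>G t\<close>.\<close>
    have "G t * measure \<rho> (tail t) \<le> measure law (tail t)"
      using dom[OF that, unfolded dominated_def, rule_format, OF tail_meas, of t] by simp
    also have "\<dots> \<le> 1" by simp
    finally show ?thesis using that by (simp add: \<rho>_tail G_def exp_minus field_simps)
  qed
  moreover have "0 \<le> sigma_bound \<gamma> S \<mu> M \<zeta> V t" if "0 \<le> t" for t
    using G_nonneg[OF that] by (simp add: G_def zero_le_mult_iff)
  ultimately show ?thesis
    using mono cont by (auto simp: admissible_def G_def[abs_def])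
qed

section \<open>Part (iii): a memoryless time yields an admissible function\<close>

text \<open>The conditional law is evaluated at \<open>shift_set t D\<close> and multiplied by the
  probability of the conditioning event. If that probability is 0, both sides vanish, so no case
  distinction is needed later.\<close>

lemma memoryless_prob_eq:
  assumes smt: "strong_memoryless_time \<gamma> S \<mu> M \<zeta> V \<zeta>h" and "0 \<le> t"
    and D: "D \<in> sets (borel \<Otimes>\<^sub>M S)"
  shows "\<P>(\<omega> in M. (\<zeta>h \<omega> \<le> t \<and> \<zeta> \<omega> > t) \<and> (\<zeta> \<omega>, V \<omega>) \<in> D) =
    \<P>(\<omega> in M. \<zeta>h \<omega> \<le> t \<and> \<zeta> \<omega> > t) * exp (\<gamma> * t) * measure \<rho> (D \<inter> tail t)"
proof -
  have \<zeta>h [measurable]: "\<zeta>h \<in> borel_measurable M"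
    using smt by (auto simp: strong_memoryless_time_def measurable_restrict_space2_iff)
  define E where "E = {\<omega> \<in> space M. \<zeta>h \<omega> \<le> t \<and> \<zeta> \<omega> > t}"
  have E [measurable]: "E \<in> sets M" unfolding E_def by measurable
  show ?thesis
  proof (cases "prob E > 0")
    case False
    then have "prob E = 0" by (simp add: not_less measure_le_0_iff)
    moreover have "\<P>(\<omega> in M. (\<zeta>h \<omega> \<le> t \<and> \<zeta> \<omega> > t) \<and> (\<zeta> \<omega>, V \<omega>) \<in> D) \<le> prob E"
      unfolding E_def using E by (intro finite_measure_mono) (auto simp: E_def)
    ultimately show ?thesis
      unfolding E_def[symmetric] by (simp add: order_antisym)
  next
    case True
    let ?X = "\<lambda>\<omega>. (\<zeta> \<omega> - t, V \<omega>)"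
    have eq: "cond_law M (borel \<Otimes>\<^sub>M S) ?X E = \<rho>"
      using smt True \<open>0 \<le> t\<close> by (auto simp: strong_memoryless_time_def E_def)
    have "measure \<rho> (shift_set t D) = measure (uniform_measure M E) (?X -` shift_set t D \<inter> space M)"
      unfolding eq[symmetric] cond_law_def using D by (subst measure_distr) auto
    also have "\<dots> = prob (E \<inter> (?X -` shift_set t D \<inter> space M)) / prob E"
      using True D by (subst measure_uniform_measure) (auto simp: emeasure_eq_measure)
    also have "E \<inter> (?X -` shift_set t D \<inter> space M) =
        {\<omega> \<in> space M. (\<zeta>h \<omega> \<le> t \<and> \<zeta> \<omega> > t) \<and> (\<zeta> \<omega>, V \<omega>) \<in> D}"
      using V_space by (auto simp: E_def shift_set_def tail_def)
    finally show ?thesis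
      using True \<open>0 \<le> t\<close> D by (simp add: \<rho>_shift E_def[symmetric] exp_minus field_simps)
  qed
qed

text \<open>Dropping the condition on \<open>\<zeta>h\<close> from the events of
  \<open>memoryless_prob_eq\<close> gives the bound. Monotonicity comes from comparing events at two
  times, right-continuity from distribution functions.\<close>

lemma admissible_memoryless:
  assumes smt: "strong_memoryless_time \<gamma> S \<mu> M \<zeta> V \<zeta>h"
  shows "admissible \<gamma> S \<mu> M \<zeta> V (\<lambda>t. \<P>(\<omega> in M. \<zeta>h \<omega> \<le> t \<and> \<zeta> \<omega> > t))"
proof -
  define \<sigma> where "\<sigma> t = \<P>(\<omega> in M. \<zeta>h \<omega> \<le> t \<and> \<zeta> \<omega> > t)" for t
  have \<zeta>h [measurable]: "\<zeta>h \<in> borel_measurable M"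
    using smt by (auto simp: strong_memoryless_time_def measurable_restrict_space2_iff)
  have le_AE: "AE \<omega> in M. \<zeta>h \<omega> \<le> \<zeta> \<omega>"
    using smt by (subst prob_Collect_eq_1[symmetric]) (auto simp: strong_memoryless_time_def)
  have key: "\<P>(\<omega> in M. (\<zeta>h \<omega> \<le> t \<and> \<zeta> \<omega> > t) \<and> (\<zeta> \<omega>, V \<omega>) \<in> D) =
      \<sigma> t * exp (\<gamma> * t) * measure \<rho> (D \<inter> tail t)" if "0 \<le> t" "D \<in> sets (borel \<Otimes>\<^sub>M S)" for t and D :: "(real \<times> 's) set"
    using memoryless_prob_eq[OF smt that] by (simp add: \<sigma>_def)
  have bound: "\<sigma> t \<le> sigma_bound \<gamma> S \<mu> M \<zeta> V t" if "0 \<le> t" for t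
    unfolding le_sigma_bound_iff[OF that]
  proof
    fix D :: "(real \<times> 's) set" assume D [measurable]: "D \<in> sets (borel \<Otimes>\<^sub>M S)"
    have "\<P>(\<omega> in M. (\<zeta>h \<omega> \<le> t \<and> \<zeta> \<omega> > t) \<and> (\<zeta> \<omega>, V \<omega>) \<in> D) \<le> measure law (D \<inter> tail t)"
      using V_space by (subst law_eq) (auto simp: tail_def intro!: finite_measure_mono)
    then show "\<sigma> t * exp (\<gamma> * t) * measure \<rho> (D \<inter> tail t) \<le> measure law (D \<inter> tail t)"
      by (subst key[OF that D, symmetric])
  qed
  have mono: "\<sigma> s * exp (\<gamma> * s) \<le> \<sigma> t * exp (\<gamma> * t)" if "0 \<le> s" "s \<le> t" for s t
  proof -
    \<comment> \<open>The test set \<open>tail t\<close> is used at the earlier time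
      \<open>s\<close>: an event with \<open>\<zeta>h \<le> s\<close> and \<open>\<zeta> > t\<close>
      is contained in the one that defines \<open>\<sigma> t\<close>.\<close>
    have "\<sigma> s * exp (\<gamma> * s) * measure \<rho> (tail t) =
        \<P>(\<omega> in M. (\<zeta>h \<omega> \<le> s \<and> \<zeta> \<omega> > s) \<and> (\<zeta> \<omega>, V \<omega>) \<in> tail t)"
    proof -
      have "tail t \<inter> tail s = tail t" using that by (auto simp: tail_def)
      then show ?thesis using that by (subst key) auto
    qed
    also have "\<dots> \<le> \<sigma> t"
      unfolding \<sigma>_def using that by (intro finite_measure_mono) (auto simp: tail_def)
    finally show ?thesis
      using that by (simp add: \<rho>_tail exp_minus field_simps)
  qed
  \<comment> \<open>Almost surely \<open>\<zeta> \<le> t\<close> forces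
    \<open>\<zeta>h \<le> t\<close>, so \<open>\<sigma>\<close> is a difference of two
    right-continuous distribution functions.\<close>
  have \<sigma>_eq: "\<sigma> t = cdf (distr M borel \<zeta>h) t - cdf (distr M borel \<zeta>) t" for t
  proof -
    have "prob {\<omega> \<in> space M. \<zeta>h \<omega> \<le> t} =
        \<sigma> t + prob {\<omega> \<in> space M. \<zeta>h \<omega> \<le> t \<and> \<zeta> \<omega> \<le> t}"
      unfolding \<sigma>_def by (subst finite_measure_Union[symmetric]) (auto intro!: arg_cong[of _ _ prob])
    also have "prob {\<omega> \<in> space M. \<zeta>h \<omega> \<le> t \<and> \<zeta> \<omega> \<le> t} = prob {\<omega> \<in> space M. \<zeta> \<omega> \<le> t}"
      using le_AE by (intro measure_eq_AE) (auto elim!: eventually_mono)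
    finally show ?thesis
      by (simp add: cdf_def measure_distr vimage_def Int_def conj_commute)
  qed
  interpret h: real_distribution "distr M borel \<zeta>h"
    by (intro real_distribution_distr) simp
  interpret z: real_distribution "distr M borel \<zeta>"
    by (intro real_distribution_distr) simp
  have "continuous (at_right t) (\<lambda>t. \<sigma> t * exp (\<gamma> * t))" for t
    unfolding \<sigma>_eq
    by (intro continuous_mult continuous_diff h.cdf_is_right_cont z.cdf_is_right_cont) (intro continuous_intros)
  moreover have "0 \<le> \<sigma> t" "\<sigma> t \<le> 1" for t
    by (simp_all add: \<sigma>_def)
  ultimately have "admissible \<gamma> S \<mu> M \<zeta> V \<sigma>"
    unfolding admissible_def using bound mono by (auto intro!: mono_onI)
  then show ?thesis by (simp only: \<sigma>_def[abs_def])
qed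

section \<open>The density of the dominated part of \<open>\<rho>\<close>\<close>

text \<open>Let \<open>Y\<close> be the set where \<open>g * h > 1\<close>. Domination bounds the
  integral of \<open>g * h\<close> over \<open>Y \<inter> tail t\<close> by the \<open>law\<close>
  of that set, so the positive excess \<open>g * h - 1\<close> has integral 0 there.\<close>

lemma dominated_AE_le_1:
  assumes dom: "dominated t g" and "0 \<le> g"
    and h [measurable]: "h \<in> borel_measurable (borel \<Otimes>\<^sub>M S)" and h_nonneg: "\<And>p. 0 \<le> h p"
    and h_int: "\<And>D. D \<in> sets (borel \<Otimes>\<^sub>M S) \<Longrightarrow>
      (\<integral>\<^sup>+p. ennreal (g * h p) * indicator (D \<inter> tail t) p \<partial>law) = ennreal (g * measure \<rho> (D \<inter> tail t))"
  shows "AE p in law. p \<in> tail t \<longrightarrow> g * h p \<le> 1"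
proof -
  define Y where "Y = {p \<in> space (borel \<Otimes>\<^sub>M S). 1 < g * h p}"
  have Y [measurable]: "Y \<in> sets (borel \<Otimes>\<^sub>M S)" unfolding Y_def by measurable
  let ?k = "\<lambda>p. ennreal (g * h p - 1) * indicator (Y \<inter> tail t) p"
  have "(\<integral>\<^sup>+p. ?k p \<partial>law) + emeasure law (Y \<inter> tail t)
      = (\<integral>\<^sup>+p. ?k p \<partial>law) + (\<integral>\<^sup>+p. indicator (Y \<inter> tail t) p \<partial>law)"
    by simp
  also have "\<dots> = (\<integral>\<^sup>+p. ?k p + indicator (Y \<inter> tail t) p \<partial>law)"
    by (rule nn_integral_add[symmetric]) auto
  also have "\<dots> = (\<integral>\<^sup>+p. ennreal (g * h p) * indicator (Y \<inter> tail t) p \<partial>law)"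
  proof -
    have "ennreal (x - 1) + 1 = ennreal x" if "1 < x" for x
      using that ennreal_plus[of "x - 1" 1] by simp
    then show ?thesis
      by (intro nn_integral_cong) (auto simp: Y_def indicator_def)
  qed
  also have "\<dots> = ennreal (g * measure \<rho> (Y \<inter> tail t))" by (rule h_int) simp
  also have "\<dots> \<le> 0 + emeasure law (Y \<inter> tail t)"
    using dom by (auto simp: dominated_def law.emeasure_eq_measure intro!: ennreal_leI)
  finally have "(\<integral>\<^sup>+p. ?k p \<partial>law) = 0"
    using ennreal_add_left_cancel_le[of "emeasure law (Y \<inter> tail t)" "\<integral>\<^sup>+p. ?k p \<partial>law" 0]
    by (simp add: add.commute law.emeasure_eq_measure)
  then have "AE p in law. ?k p = 0"
    by (subst (asm) nn_integral_0_iff_AE) auto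
  then show ?thesis
    using AE_space[of law]
    by eventually_elim
       (auto simp: Y_def indicator_def space_pair_measure split: if_splits)
qed

text \<open>Above a time \<open>t\<close> with \<open>G t > 0\<close> the measure \<open>\<rho>\<close> is dominated by a multiple of
  \<open>law\<close>, so \<open>\<rho>\<close> has a density \<open>h\<close> with respect to \<open>law\<close> on the union of these regions.\<close>

lemma dominated_density:
  assumes mono: "mono_on {0..} G" and nonneg: "\<And>t. 0 \<le> t \<Longrightarrow> 0 \<le> G t"
    and dom: "\<And>t. 0 \<le> t \<Longrightarrow> dominated t (G t)"
  obtains h where "h \<in> borel_measurable (borel \<Otimes>\<^sub>M S)" "\<And>p. (0::real) \<le> h p"
    "\<And>t D. 0 \<le> t \<Longrightarrow> D \<in> sets (borel \<Otimes>\<^sub>M S) \<Longrightarrow>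
      (\<integral>\<^sup>+p. ennreal (min 1 (G t * h p)) * indicator (D \<inter> tail t) p \<partial>law)
        = ennreal (G t * measure \<rho> (D \<inter> tail t))"
proof -
  \<comment> \<open>Rational times make the region \<open>B\<close> a countable union of tails,
    which keeps it measurable and lets null sets be treated one tail at a time.\<close>
  define Q where "Q = {q \<in> \<rat>. 0 \<le> q \<and> G q > 0}"
  have "countable Q" by (auto simp: Q_def intro: countable_subset[OF _ countable_rat])
  define B where "B = (\<Union>q\<in>Q. tail q)"
  have B [measurable]: "B \<in> sets (borel \<Otimes>\<^sub>M S)"
    unfolding B_def using \<open>countable Q\<close> by (intro sets.countable_UN') auto
  \<comment> \<open>Outside \<open>B\<close> nothing relates \<open>\<rho>\<close> to
    \<open>law\<close>, so only the restriction of \<open>\<rho>\<close> to \<open>B\<close> is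
    differentiated.\<close>
  define N where "N = density \<rho> (indicator B)"
  have sets_N: "sets N = sets law" by (simp add: N_def)
  have N: "emeasure N X = emeasure \<rho> (B \<inter> X)" if "X \<in> sets (borel \<Otimes>\<^sub>M S)" for X
    unfolding N_def using that by (subst emeasure_density) (auto simp: indicator_inter_arith[symmetric])
  have "finite_measure N"
    using N[of "space N"] sets.top[of N] sets_N
    by (intro finite_measureI) (simp add: \<rho>.emeasure_eq_measure)
  have "absolutely_continuous law N"
    unfolding absolutely_continuous_def
  proof
    fix X assume X: "X \<in> null_sets law"
    then have X_sets [measurable]: "X \<in> sets (borel \<Otimes>\<^sub>M S)" by (auto simp: null_sets_def)
    have "X \<inter> tail q \<in> null_sets \<rho>" if "q \<in> Q" for q
    proof -
      have "measure law (X \<inter> tail q) \<le> measure law X"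
        by (intro law.finite_measure_mono) auto
      also have "\<dots> = 0" using X by (simp add: null_sets_def law.emeasure_eq_measure)
      finally have law_0: "measure law (X \<inter> tail q) \<le> 0" .
      have "0 \<le> q" "G q > 0" using that by (auto simp: Q_def)
      then have "G q * measure \<rho> (X \<inter> tail q) \<le> measure law (X \<inter> tail q)"
        using dom[of q] X_sets unfolding dominated_def by blast
      with law_0 have "G q * measure \<rho> (X \<inter> tail q) \<le> 0" by (rule order_trans[rotated])
      then have "measure \<rho> (X \<inter> tail q) = 0"
        using \<open>G q > 0\<close> measure_nonneg[of \<rho> "X \<inter> tail q"] by (auto simp: mult_le_0_iff simp del: measure_nonneg)
      then show ?thesis by (simp add: null_sets_def \<rho>.emeasure_eq_measure)
    qed
    then have "(\<Union>q\<in>Q. X \<inter> tail q) \<in> null_sets \<rho>"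
      using \<open>countable Q\<close> by (intro null_sets_UN') auto
    also have "(\<Union>q\<in>Q. X \<inter> tail q) = B \<inter> X" by (auto simp: B_def)
    finally have "emeasure N X = 0" by (simp add: N null_sets_def)
    then show "X \<in> null_sets N" by (simp add: null_sets_def sets_N)
  qed
  from law.real_RN_deriv[OF \<open>finite_measure N\<close> this sets_N]
  obtain h where h: "h \<in> borel_measurable law" "AE p in law. RN_deriv law N p = ennreal (h p)"
    and h_nonneg: "\<And>p. 0 \<le> h p" by metis
  then have [measurable]: "h \<in> borel_measurable (borel \<Otimes>\<^sub>M S)" by simp
  have "density law (\<lambda>p. ennreal (h p)) = N"
    using h by (subst law.density_RN_deriv[OF \<open>absolutely_continuous law N\<close> sets_N, symmetric])
      (intro density_cong, auto elim!: eventually_mono)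
  then have h_N: "(\<integral>\<^sup>+p. ennreal (h p) * indicator X p \<partial>law) = emeasure N X"
    if "X \<in> sets (borel \<Otimes>\<^sub>M S)" for X
    using that by (auto simp: emeasure_density)
  have h_int: "(\<integral>\<^sup>+p. ennreal (G t * h p) * indicator (D \<inter> tail t) p \<partial>law)
        = ennreal (G t * measure \<rho> (D \<inter> tail t))"
    if t: "0 \<le> t" and D [measurable]: "D \<in> sets (borel \<Otimes>\<^sub>M S)" for t D
  proof (cases "G t = 0")
    case False
    then have "G t > 0" using nonneg[OF t] by simp
    \<comment> \<open>A rational \<open>q\<close> strictly between \<open>t\<close> and the first
      coordinate inherits \<open>G q > 0\<close> by monotonicity.\<close>
    have "tail t \<subseteq> B"
    proof
      fix p assume p: "p \<in> tail t"
      then obtain q where q: "q \<in> \<rat>" "t < q" "q < fst p"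
        using Rats_dense_in_real[of t "fst p"] by (auto simp: tail_def)
      then have "G t \<le> G q" using t by (intro monotone_onD[OF mono]) auto
      then have "q \<in> Q" using q t \<open>G t > 0\<close> by (simp add: Q_def)
      then show "p \<in> B" using p q by (auto simp: B_def tail_def)
    qed
    then have "B \<inter> (D \<inter> tail t) = D \<inter> tail t" by blast
    then have "emeasure N (D \<inter> tail t) = ennreal (measure \<rho> (D \<inter> tail t))"
      by (simp add: N \<rho>.emeasure_eq_measure)
    moreover have "(\<integral>\<^sup>+p. ennreal (G t * h p) * indicator (D \<inter> tail t) p \<partial>law)
        = ennreal (G t) * (\<integral>\<^sup>+p. ennreal (h p) * indicator (D \<inter> tail t) p \<partial>law)"
      using \<open>G t > 0\<close> h_nonneg
      by (subst nn_integral_cmult[symmetric]) (auto simp: ennreal_mult mult.assoc)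
    ultimately show ?thesis
      using \<open>G t > 0\<close> by (simp add: h_N ennreal_mult)
  qed simp
  show ?thesis
  proof (rule that)
    fix t :: real and D :: "(real \<times> 's) set" assume t: "0 \<le> t" and D: "D \<in> sets (borel \<Otimes>\<^sub>M S)"
    \<comment> \<open>For fixed \<open>t\<close> the truncation at 1 changes the integrand only on a
      null set. It is built in because a uniform variable lies below a level
      \<open>x \<ge> 0\<close> with probability \<open>min 1 x\<close>.\<close>
    have "AE p in law. p \<in> tail t \<longrightarrow> G t * h p \<le> 1"
      using t by (intro dominated_AE_le_1 dom nonneg h_int h_nonneg) auto
    then have "(\<integral>\<^sup>+p. ennreal (min 1 (G t * h p)) * indicator (D \<inter> tail t) p \<partial>law)
        = (\<integral>\<^sup>+p. ennreal (G t * h p) * indicator (D \<inter> tail t) p \<partial>law)"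
      by (intro nn_integral_cong_AE) (auto elim!: eventually_mono simp: indicator_def min_def)
    then show "(\<integral>\<^sup>+p. ennreal (min 1 (G t * h p)) * indicator (D \<inter> tail t) p \<partial>law)
        = ennreal (G t * measure \<rho> (D \<inter> tail t))"
      by (simp only: h_int[OF t D])
  qed (simp_all add: h_nonneg)
qed

section \<open>Part (i): construction on an enlarged space\<close>

text \<open>The second coordinate is the uniform variable independent of
  \<open>(\<zeta>, V)\<close>.\<close>

definition randomized :: "('a \<times> real) measure" where
  "randomized = M \<Otimes>\<^sub>M uniform_measure lborel {0..1}"

lemma prob_space_uniform: "prob_space (uniform_measure lborel {0..1::real})"
  by (rule prob_space_uniform_measure) auto

lemma space_randomized: "space randomized = space M \<times> UNIV"
  by (simp add: randomized_def space_pair_measure)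

lemma fst_randomized [measurable]: "fst \<in> randomized \<rightarrow>\<^sub>M M"
  by (simp add: randomized_def)

lemma snd_randomized [measurable]: "snd \<in> borel_measurable randomized"
  unfolding randomized_def by (intro measurable_snd'') (simp add: measurable_def)

sublocale R: prob_space randomized
proof -
  interpret U: prob_space "uniform_measure lborel {0..1::real}" by (rule prob_space_uniform)
  interpret pair_prob_space M "uniform_measure lborel {0..1::real}" ..
  show "prob_space randomized" unfolding randomized_def by unfold_locales
qed

lemma distr_fst_randomized: "distr randomized M fst = M"
  unfolding randomized_def
  by (rule prob_space.distr_pair_fst[OF prob_space_uniform])

text \<open>By Fubini: for a fixed first coordinate in \<open>E\<close>, the section is a half-line
  whose uniform measure is \<open>min 1 (f \<omega>)\<close>.\<close>

lemma emeasure_randomized_below: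
  assumes [measurable]: "f \<in> borel_measurable M" and E [measurable]: "E \<in> sets M"
    and nonneg: "\<And>\<omega>. 0 \<le> f \<omega>"
  shows "emeasure randomized {p \<in> space randomized. fst p \<in> E \<and> snd p \<le> f (fst p)} =
    (\<integral>\<^sup>+\<omega>. ennreal (min 1 (f \<omega>)) * indicator E \<omega> \<partial>M)"
proof -
  interpret U: prob_space "uniform_measure lborel {0..1::real}" by (rule prob_space_uniform)
  let ?X = "{p \<in> space randomized. fst p \<in> E \<and> snd p \<le> f (fst p)}"
  have "?X \<in> sets randomized" by measurable
  then have "emeasure randomized ?X =
      (\<integral>\<^sup>+\<omega>. emeasure (uniform_measure lborel {0..1::real}) (Pair \<omega> -` ?X) \<partial>M)"
    unfolding randomized_def by (rule U.emeasure_pair_measure_alt)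
  also have "\<dots> = (\<integral>\<^sup>+\<omega>. ennreal (min 1 (f \<omega>)) * indicator E \<omega> \<partial>M)"
  proof (rule nn_integral_cong)
    fix \<omega> assume \<omega>: "\<omega> \<in> space M"
    have "{0..1} \<inter> {..f \<omega>} = {0..min 1 (f \<omega>)}" by auto
    then have "emeasure (uniform_measure lborel {0..1}) {..f \<omega>} = ennreal (min 1 (f \<omega>))"
      using nonneg[of \<omega>] by (simp add: divide_ennreal_def)
    moreover have "Pair \<omega> -` ?X = (if \<omega> \<in> E then {..f \<omega>} else {})"
      using \<omega> by (auto simp: space_randomized)
    ultimately show "emeasure (uniform_measure lborel {0..1::real}) (Pair \<omega> -` ?X) =
        ennreal (min 1 (f \<omega>)) * indicator E \<omega>"
      by simp
  qed
  finally show ?thesis .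
qed

text \<open>On \<open>\<zeta> > t\<close> the time has arrived by \<open>t\<close> exactly when the
  uniform variable is at most \<open>G t * h (\<zeta>, V)\<close>. Integrating this probability over
  \<open>D \<inter> tail t\<close> gives the \<open>\<rho>\<close>-mass because \<open>h\<close> is
  the density.\<close>

lemma exists_memoryless_time:
  assumes adm: "admissible \<gamma> S \<mu> M \<zeta> V \<sigma>"
  obtains \<zeta>h where "\<zeta>h \<in> borel_measurable randomized"
    "\<And>p. p \<in> space randomized \<Longrightarrow> 0 \<le> \<zeta>h p \<and> \<zeta>h p \<le> \<zeta> (fst p)"
    "\<And>t D. 0 \<le> t \<Longrightarrow> D \<in> sets (borel \<Otimes>\<^sub>M S) \<Longrightarrow>
      \<P>(p in randomized. (\<zeta>h p \<le> t \<and> \<zeta> (fst p) > t) \<and> (\<zeta> (fst p), V (fst p)) \<in> D)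
        = \<sigma> t * exp (\<gamma> * t) * measure \<rho> (D \<inter> tail t)"
proof -
  define G where "G t = \<sigma> t * exp (\<gamma> * t)" for t
  have mono: "mono_on {0..} G" and cont: "\<And>t. 0 \<le> t \<Longrightarrow> continuous (at_right t) G"
    and nonneg: "\<And>t. 0 \<le> t \<Longrightarrow> 0 \<le> G t"
    and dom: "\<And>t. 0 \<le> t \<Longrightarrow> dominated t (G t)"
    using adm by (auto simp: admissible_def G_def[abs_def] le_sigma_bound_iff_dominated)
  obtain h where h [measurable]: "h \<in> borel_measurable (borel \<Otimes>\<^sub>M S)"
    and h_nonneg: "\<And>p. (0::real) \<le> h p"
    and h_int: "\<And>t D. 0 \<le> t \<Longrightarrow> D \<in> sets (borel \<Otimes>\<^sub>M S) \<Longrightarrow>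
      (\<integral>\<^sup>+p. ennreal (min 1 (G t * h p)) * indicator (D \<inter> tail t) p \<partial>law)
        = ennreal (G t * measure \<rho> (D \<inter> tail t))"
    using dominated_density[OF mono nonneg dom] by blast
  define H where "H \<omega> = h (\<zeta> \<omega>, V \<omega>)" for \<omega>
  have H [measurable]: "H \<in> borel_measurable M" unfolding H_def by measurable
  \<comment> \<open>The times by which arrival has happened. As \<open>G\<close> is nondecreasing
    and \<open>H\<close> nonnegative, the set is closed upwards; right-continuity of
    \<open>G\<close> makes it contain its infimum, which is what \<open>le_iff\<close>
    needs.\<close>
  define R where "R p = {t. 0 \<le> t \<and> (\<zeta> (fst p) \<le> t \<or> snd p \<le> G t * H (fst p))}" for p :: "'a \<times> real"
  define \<zeta>h where "\<zeta>h p = Inf (R p)" for p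
  have \<zeta>_in: "\<zeta> (fst p) \<in> R p" if "p \<in> space randomized" for p
    using that \<zeta>_nonneg by (auto simp: R_def space_randomized)
  have bdd: "bdd_below (R p)" for p
    by (rule bdd_belowI[of _ 0]) (simp add: R_def)
  have le_iff: "\<zeta>h p \<le> t \<longleftrightarrow> t \<in> R p" if p: "p \<in> space randomized" and t: "0 \<le> t" for p t
  proof
    assume "t \<in> R p"
    then show "\<zeta>h p \<le> t" unfolding \<zeta>h_def by (rule cInf_lower) (rule bdd)
  next
    assume le: "\<zeta>h p \<le> t"
    show "t \<in> R p"
    proof (rule ccontr)
      assume "t \<notin> R p"
      then have *: "t < \<zeta> (fst p)" "G t * H (fst p) < snd p" using t by (auto simp: R_def)
      \<comment> \<open>Right-continuity keeps the threshold below \<open>snd p\<close> on an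
        interval after \<open>t\<close>, and monotonicity keeps it there before \<open>t\<close>. So
        no arrival occurs before \<open>min b (\<zeta> (fst p))\<close>, which exceeds
        \<open>t\<close>.\<close>
      have "((\<lambda>s. G s * H (fst p)) \<longlongrightarrow> G t * H (fst p)) (at_right t)"
        using cont[OF t] by (intro tendsto_mult_right) (simp add: continuous_within)
      from order_tendstoD(2)[OF this *(2)]
      obtain b where b: "t < b" "\<And>s. t < s \<Longrightarrow> s < b \<Longrightarrow> G s * H (fst p) < snd p"
        by (auto simp: eventually_at_right_field)
      have "min b (\<zeta> (fst p)) \<le> Inf (R p)"
      proof (rule cInf_greatest)
        show "R p \<noteq> {}" using \<zeta>_in[OF p] by auto
        fix s assume s: "s \<in> R p"
        show "min b (\<zeta> (fst p)) \<le> s"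
        proof (rule ccontr)
          assume "\<not> min b (\<zeta> (fst p)) \<le> s"
          then have s': "s < b" "s < \<zeta> (fst p)" by auto
          with s have s_le: "0 \<le> s" "snd p \<le> G s * H (fst p)" by (auto simp: R_def)
          show False
          proof (cases "t < s")
            case True
            then show False using b(2)[of s] s' s_le by simp
          next
            case False
            then have "G s * H (fst p) \<le> G t * H (fst p)"
              using s_le t monotone_onD[OF mono, of s t] by (intro mult_right_mono) (auto simp: H_def h_nonneg)
            then show False using s_le *(2) by simp
          qed
        qed
      qed
      then show False using le b(1) *(1) by (simp add: \<zeta>h_def)
    qed
  qed
  have \<zeta>h_nonneg: "0 \<le> \<zeta>h p" if "p \<in> space randomized" for p
    unfolding \<zeta>h_def using \<zeta>_in[OF that] by (intro cInf_greatest) (auto simp: R_def)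
  show ?thesis
  proof (rule that)
    show "\<zeta>h \<in> borel_measurable randomized"
      unfolding borel_measurable_iff_le
    proof
      fix t
      show "{p \<in> space randomized. \<zeta>h p \<le> t} \<in> sets randomized"
      proof (cases "0 \<le> t")
        case True
        then have "{p \<in> space randomized. \<zeta>h p \<le> t} =
            {p \<in> space randomized. \<zeta> (fst p) \<le> t \<or> snd p \<le> G t * H (fst p)}"
          using le_iff by (auto simp: R_def)
        also have "\<dots> \<in> sets randomized" by measurable
        finally show ?thesis .
      next
        case False
        then have "{p \<in> space randomized. \<zeta>h p \<le> t} = {}" using \<zeta>h_nonneg by fastforce
        then show ?thesis by (simp only: sets.empty_sets)
      qed
    qed
    show "0 \<le> \<zeta>h p \<and> \<zeta>h p \<le> \<zeta> (fst p)" if p: "p \<in> space randomized" for p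
    proof -
      have "0 \<le> \<zeta> (fst p)" using p \<zeta>_nonneg by (auto simp: space_randomized)
      then show ?thesis using \<zeta>h_nonneg[OF p] le_iff[OF p] \<zeta>_in[OF p] by simp
    qed
    fix t :: real and D :: "(real \<times> 's) set" assume t: "0 \<le> t" and D [measurable]: "D \<in> sets (borel \<Otimes>\<^sub>M S)"
    define E where "E = {\<omega> \<in> space M. (\<zeta> \<omega>, V \<omega>) \<in> D \<inter> tail t}"
    have E [measurable]: "E \<in> sets M" unfolding E_def by measurable
    \<comment> \<open>Membership in \<open>tail t\<close> rules out the alternative
      \<open>\<zeta> \<le> t\<close> in \<open>R p\<close>, leaving only the threshold
      condition.\<close>
    have "{p \<in> space randomized. (\<zeta>h p \<le> t \<and> \<zeta> (fst p) > t) \<and> (\<zeta> (fst p), V (fst p)) \<in> D} =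
        {p \<in> space randomized. fst p \<in> E \<and> snd p \<le> G t * H (fst p)}"
      using le_iff t V_space by (auto simp: R_def E_def tail_def space_randomized)
    also have "emeasure randomized \<dots> = (\<integral>\<^sup>+\<omega>. ennreal (min 1 (G t * H \<omega>)) * indicator E \<omega> \<partial>M)"
      using nonneg[OF t] by (intro emeasure_randomized_below) (auto simp: H_def h_nonneg)
    also have "\<dots> = (\<integral>\<^sup>+p. ennreal (min 1 (G t * h p)) * indicator (D \<inter> tail t) p \<partial>law)"
      unfolding law_def
      by (subst nn_integral_distr) (auto intro!: nn_integral_cong simp: H_def E_def indicator_def)
    also have "\<dots> = ennreal (G t * measure \<rho> (D \<inter> tail t))" by (rule h_int[OF t D])
    finally show "\<P>(p in randomized. (\<zeta>h p \<le> t \<and> \<zeta> (fst p) > t) \<and> (\<zeta> (fst p), V (fst p)) \<in> D)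
        = \<sigma> t * exp (\<gamma> * t) * measure \<rho> (D \<inter> tail t)"
      using nonneg[OF t] by (simp add: R.emeasure_eq_measure G_def)
  qed
qed

section \<open>Joint law and conditional law of the constructed time\<close>

lemma randomized_pair [measurable]:
  "(\<lambda>p. (\<zeta> (fst p), V (fst p))) \<in> randomized \<rightarrow>\<^sub>M restrict_space borel {0..} \<Otimes>\<^sub>M S"
  using measurable_comp[OF fst_randomized pair_meas0] by (simp add: comp_def)

lemma distr_randomized_pair:
  "distr randomized (restrict_space borel {0..} \<Otimes>\<^sub>M S) (\<lambda>p. (\<zeta> (fst p), V (fst p))) =
    distr M (restrict_space borel {0..} \<Otimes>\<^sub>M S) (\<lambda>\<omega>. (\<zeta> \<omega>, V \<omega>))"
  using distr_distr[OF pair_meas0 fst_randomized] by (simp add: distr_fst_randomized comp_def)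

text \<open>Split at \<open>\<zeta> \<le> t\<close>. There \<open>\<zeta>h \<le> t\<close> is
  automatic, which yields the first term; on \<open>\<zeta> > t\<close> the hypothesis on events
  applies to the rectangle \<open>{..u} \<times> A\<close>.\<close>

lemma joint_law_memoryless_time:
  assumes [measurable]: "\<zeta>h \<in> borel_measurable randomized"
    and le: "\<And>p. p \<in> space randomized \<Longrightarrow> \<zeta>h p \<le> \<zeta> (fst p)"
    and law: "\<And>t D. 0 \<le> t \<Longrightarrow> D \<in> sets (borel \<Otimes>\<^sub>M S) \<Longrightarrow>
      \<P>(p in randomized. (\<zeta>h p \<le> t \<and> \<zeta> (fst p) > t) \<and> (\<zeta> (fst p), V (fst p)) \<in> D)
        = \<sigma> t * exp (\<gamma> * t) * measure \<rho> (D \<inter> tail t)"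
    and t: "0 \<le> t" and A [measurable]: "A \<in> sets S"
  shows "\<P>(p in randomized. \<zeta>h p \<le> t \<and> \<zeta> (fst p) \<le> u \<and> V (fst p) \<in> A) =
    \<P>(p in randomized. \<zeta> (fst p) \<le> min t u \<and> V (fst p) \<in> A)
      + \<sigma> t * (1 - exp (- \<gamma> * max (u - t) 0)) * measure \<mu> A"
proof -
  let ?D = "{..u} \<times> A"
  have "{p \<in> space randomized. \<zeta>h p \<le> t \<and> \<zeta> (fst p) \<le> u \<and> V (fst p) \<in> A} =
      {p \<in> space randomized. \<zeta> (fst p) \<le> min t u \<and> V (fst p) \<in> A} \<union>
      {p \<in> space randomized. (\<zeta>h p \<le> t \<and> \<zeta> (fst p) > t) \<and> (\<zeta> (fst p), V (fst p)) \<in> ?D}"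
    using le by (auto intro: order_trans)
  then have "\<P>(p in randomized. \<zeta>h p \<le> t \<and> \<zeta> (fst p) \<le> u \<and> V (fst p) \<in> A) =
      \<P>(p in randomized. \<zeta> (fst p) \<le> min t u \<and> V (fst p) \<in> A) +
      \<P>(p in randomized. (\<zeta>h p \<le> t \<and> \<zeta> (fst p) > t) \<and> (\<zeta> (fst p), V (fst p)) \<in> ?D)"
    by (simp only:) (rule R.finite_measure_Union, auto)
  also have "\<P>(p in randomized. (\<zeta>h p \<le> t \<and> \<zeta> (fst p) > t) \<and> (\<zeta> (fst p), V (fst p)) \<in> ?D) =
      \<sigma> t * exp (\<gamma> * t) * measure \<rho> (?D \<inter> tail t)"
    using t by (rule law) simp
  also have "measure \<rho> (?D \<inter> tail t) = (exp (- \<gamma> * t) - exp (- \<gamma> * max t u)) * measure \<mu> A"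
  proof -
    \<comment> \<open>The strip between \<open>t\<close> and \<open>u\<close> is a difference of two
      tails; with \<open>max t u\<close> these coincide when \<open>u \<le> t\<close>, as the strip
      is then empty.\<close>
    have "?D \<inter> tail t = (UNIV \<times> A) \<inter> tail t - (UNIV \<times> A) \<inter> tail (max t u)"
      using sets.sets_into_space[OF A] by (auto simp: tail_def)
    also have "measure \<rho> \<dots> =
        measure \<rho> ((UNIV \<times> A) \<inter> tail t) - measure \<rho> ((UNIV \<times> A) \<inter> tail (max t u))"
      by (rule \<rho>.finite_measure_Diff) (auto simp: tail_def)
    finally show ?thesis
      using t A by (simp only: \<rho>_tail_Times max.coboundedI1 left_diff_distrib)
  qed
  also have "\<sigma> t * exp (\<gamma> * t) * ((exp (- \<gamma> * t) - exp (- \<gamma> * max t u)) * measure \<mu> A) =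
      \<sigma> t * (1 - exp (- \<gamma> * max (u - t) 0)) * measure \<mu> A"
  proof -
    have "exp (\<gamma> * t) * (exp (- \<gamma> * t) - exp (- \<gamma> * max t u)) = 1 - exp (- \<gamma> * max (u - t) 0)"
      by (simp add: right_diff_distrib exp_add[symmetric] max_def algebra_simps)
    then show ?thesis by (metis mult.assoc)
  qed
  finally show ?thesis .
qed

text \<open>The hypothesis factors each event probability into \<open>\<sigma> t\<close> and a
  \<open>\<rho>\<close>-mass. Conditioning divides by the probability of \<open>E\<close>, which is
  \<open>\<sigma> t\<close>, and leaves \<open>\<rho>\<close>.\<close>

lemma strong_memoryless_randomized:
  assumes meas [measurable]: "\<zeta>h \<in> borel_measurable randomized"
    and le: "\<And>p. p \<in> space randomized \<Longrightarrow> 0 \<le> \<zeta>h p \<and> \<zeta>h p \<le> \<zeta> (fst p)"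
    and law: "\<And>t D. 0 \<le> t \<Longrightarrow> D \<in> sets (borel \<Otimes>\<^sub>M S) \<Longrightarrow>
      \<P>(p in randomized. (\<zeta>h p \<le> t \<and> \<zeta> (fst p) > t) \<and> (\<zeta> (fst p), V (fst p)) \<in> D)
        = \<sigma> t * exp (\<gamma> * t) * measure \<rho> (D \<inter> tail t)"
  shows "strong_memoryless_time \<gamma> S \<mu> randomized (\<lambda>p. \<zeta> (fst p)) (\<lambda>p. V (fst p)) \<zeta>h"
  unfolding strong_memoryless_time_def
proof (intro conjI allI impI)
  show "\<zeta>h \<in> randomized \<rightarrow>\<^sub>M restrict_space borel {0..}"
    using le by (auto simp: measurable_restrict_space2_iff)
  have "{p \<in> space randomized. \<zeta>h p \<le> \<zeta> (fst p)} = space randomized" using le by auto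
  then show "\<P>(p in randomized. \<zeta>h p \<le> \<zeta> (fst p)) = 1" by (simp add: R.prob_space)
next
  fix t :: real
  define E where "E = {p \<in> space randomized. \<zeta>h p \<le> t \<and> \<zeta> (fst p) > t}"
  assume t: "0 \<le> t" and "\<P>(p in randomized. \<zeta>h p \<le> t \<and> \<zeta> (fst p) > t) > 0"
  then have E_pos: "measure randomized E > 0" by (simp add: E_def)
  have E [measurable]: "E \<in> sets randomized" unfolding E_def by measurable
  have "E = {p \<in> space randomized. (\<zeta>h p \<le> t \<and> \<zeta> (fst p) > t) \<and> (\<zeta> (fst p), V (fst p)) \<in> tail t}"
    using V_space by (auto simp: E_def tail_def space_randomized)
  then have prob_E: "measure randomized E = \<sigma> t"
    using law[OF t, of "tail t"] t by (simp add: \<rho>_tail exp_minus)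
  let ?X = "\<lambda>p. (\<zeta> (fst p) - t, V (fst p))"
  show "cond_law randomized (borel \<Otimes>\<^sub>M S) ?X E = \<rho>"
  proof (rule measure_eqI)
    fix C assume "C \<in> sets (cond_law randomized (borel \<Otimes>\<^sub>M S) ?X E)"
    then have C [measurable]: "C \<in> sets (borel \<Otimes>\<^sub>M S)" by (simp add: cond_law_def)
    \<comment> \<open>\<open>C\<close> moved up by \<open>t\<close>. Shifting back and cutting at
      level 0 loses only points with nonpositive first coordinate, which \<open>\<rho>\<close> does
      not charge.\<close>
    define D where "D = (\<lambda>p. (fst p + (- t), snd p)) -` C \<inter> space (borel \<Otimes>\<^sub>M S)"
    have D: "D \<in> sets (borel \<Otimes>\<^sub>M S)"
      unfolding D_def by (rule measurable_sets[OF shift_meas C])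
    have "shift_set t D = C \<inter> tail 0"
      by (auto simp: shift_set_def D_def tail_def space_pair_measure)
    then have \<rho>_D: "measure \<rho> (D \<inter> tail t) = exp (- \<gamma> * t) * measure \<rho> C"
      using \<rho>_shift[OF D t] \<rho>_tail0[OF C] by (simp only:)
    have "E \<inter> (?X -` C \<inter> space randomized) =
        {p \<in> space randomized. (\<zeta>h p \<le> t \<and> \<zeta> (fst p) > t) \<and> (\<zeta> (fst p), V (fst p)) \<in> D}"
      using V_space by (auto simp: E_def D_def space_pair_measure space_randomized)
    then have "measure randomized (E \<inter> (?X -` C \<inter> space randomized)) = \<sigma> t * measure \<rho> C"
      using law[OF t D] by (simp add: \<rho>_D exp_minus)
    then have "emeasure randomized (E \<inter> (?X -` C \<inter> space randomized)) / emeasure randomized E =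
        ennreal (measure \<rho> C)"
      using E_pos by (simp add: R.emeasure_eq_measure divide_ennreal prob_E)
    then show "emeasure (cond_law randomized (borel \<Otimes>\<^sub>M S) ?X E) C = emeasure \<rho> C"
      unfolding cond_law_def by (subst emeasure_distr) (auto simp: \<rho>.emeasure_eq_measure)
  qed (simp add: cond_law_def)
qed

end

section \<open>Existence, the maximal bound and the converse combined\<close>

theorem theorem3p1:
  fixes \<gamma> :: real and S \<mu> :: "'s measure" and M :: "'a measure"
    and \<zeta> :: "'a \<Rightarrow> real" and V :: "'a \<Rightarrow> 's"
  assumes "\<gamma> > 0"
    and "prob_space M"
    and "(\<lambda>\<omega>. (\<zeta> \<omega>, V \<omega>)) \<in> measurable M (restrict_space borel {0..} \<Otimes>\<^sub>M S)"
    and "prob_space \<mu>" and "sets \<mu> = sets S"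
  shows
    "(\<forall>\<sigma>. admissible \<gamma> S \<mu> M \<zeta> V \<sigma> \<longrightarrow>
        (\<exists>(M' :: ('a \<times> real) measure) \<zeta>' V' \<zeta>h.
           prob_space M' \<and>
           (\<lambda>\<omega>. (\<zeta>' \<omega>, V' \<omega>)) \<in> measurable M' (restrict_space borel {0..} \<Otimes>\<^sub>M S) \<and>
           distr M' (restrict_space borel {0..} \<Otimes>\<^sub>M S) (\<lambda>\<omega>. (\<zeta>' \<omega>, V' \<omega>))
             = distr M (restrict_space borel {0..} \<Otimes>\<^sub>M S) (\<lambda>\<omega>. (\<zeta> \<omega>, V \<omega>)) \<and>
           (\<forall>t\<ge>0. \<forall>u\<ge>0. \<forall>A\<in>sets S.
              \<P>(\<omega> in M'. \<zeta>h \<omega> \<le> t \<and> \<zeta>' \<omega> \<le> u \<and> V' \<omega> \<in> A)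
                = \<P>(\<omega> in M'. \<zeta>' \<omega> \<le> min t u \<and> V' \<omega> \<in> A)
                  + \<sigma> t * (1 - exp (- \<gamma> * max (u - t) 0)) * measure \<mu> A) \<and>
           strong_memoryless_time \<gamma> S \<mu> M' \<zeta>' V' \<zeta>h))
     \<and> admissible \<gamma> S \<mu> M \<zeta> V (sigma_bound \<gamma> S \<mu> M \<zeta> V)
     \<and> (\<forall>\<zeta>h. strong_memoryless_time \<gamma> S \<mu> M \<zeta> V \<zeta>h \<longrightarrow>
          admissible \<gamma> S \<mu> M \<zeta> V (\<lambda>t. \<P>(\<omega> in M. \<zeta>h \<omega> \<le> t \<and> \<zeta> \<omega> > t)))"
proof -
  interpret memoryless_setup \<gamma> S \<mu> M \<zeta> V
    using assms by (intro memoryless_setup.intro memoryless_setup_axioms.intro)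
  show ?thesis
  proof (intro conjI allI impI)
    fix \<sigma> assume "admissible \<gamma> S \<mu> M \<zeta> V \<sigma>"
    then obtain \<zeta>h where \<zeta>h: "\<zeta>h \<in> borel_measurable randomized"
      "\<And>p. p \<in> space randomized \<Longrightarrow> 0 \<le> \<zeta>h p \<and> \<zeta>h p \<le> \<zeta> (fst p)"
      "\<And>t D. 0 \<le> t \<Longrightarrow> D \<in> sets (borel \<Otimes>\<^sub>M S) \<Longrightarrow>
        \<P>(p in randomized. (\<zeta>h p \<le> t \<and> \<zeta> (fst p) > t) \<and> (\<zeta> (fst p), V (fst p)) \<in> D)
          = \<sigma> t * exp (\<gamma> * t) * measure \<rho> (D \<inter> tail t)"
      by (rule exists_memoryless_time) blast
    show "\<exists>(M' :: ('a \<times> real) measure) \<zeta>' V' \<zeta>h.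
           prob_space M' \<and>
           (\<lambda>\<omega>. (\<zeta>' \<omega>, V' \<omega>)) \<in> measurable M' (restrict_space borel {0..} \<Otimes>\<^sub>M S) \<and>
           distr M' (restrict_space borel {0..} \<Otimes>\<^sub>M S) (\<lambda>\<omega>. (\<zeta>' \<omega>, V' \<omega>))
             = distr M (restrict_space borel {0..} \<Otimes>\<^sub>M S) (\<lambda>\<omega>. (\<zeta> \<omega>, V \<omega>)) \<and>
           (\<forall>t\<ge>0. \<forall>u\<ge>0. \<forall>A\<in>sets S.
              \<P>(\<omega> in M'. \<zeta>h \<omega> \<le> t \<and> \<zeta>' \<omega> \<le> u \<and> V' \<omega> \<in> A)
                = \<P>(\<omega> in M'. \<zeta>' \<omega> \<le> min t u \<and> V' \<omega> \<in> A)
                  + \<sigma> t * (1 - exp (- \<gamma> * max (u - t) 0)) * measure \<mu> A) \<and>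
           strong_memoryless_time \<gamma> S \<mu> M' \<zeta>' V' \<zeta>h"
      using \<zeta>h
      by (intro exI[of _ randomized] exI[of _ "\<lambda>p. \<zeta> (fst p)"] exI[of _ "\<lambda>p. V (fst p)"] exI[of _ \<zeta>h]
          conjI allI impI ballI R.prob_space_axioms randomized_pair distr_randomized_pair
          joint_law_memoryless_time strong_memoryless_randomized) auto
  qed (rule admissible_sigma_bound, erule admissible_memoryless)
qed

end
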